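(* Let $p$ be an odd prime, let $a,b,c\in\mathbb{F}_p$ with $a$ and $b$ not both zero, and for a sequence $S=x_1x_2\cdots x_m$ in $\mathbb{F}_p$ let $$\varphi(S)=a\Big(\sum_{i=1}^m x_i\Big)^2+b\sum_{i=1}^m x_i^2+c\sum_{i=1}^m x_i .$$ Then the following statements are true: (i) If $a=0$ and $b\neq 0$, then $D(\varphi,p)=p$ and $$M(\varphi,p)=\{[u]^{\alpha}[-u-cb^{-1}]^{p-1-\alpha} : u\in\mathbb{F}_p\setminus\{0,-cb^{-1}\},\ 0\le\alpha\le p-1\}.$$ (ii) If $a\neq 0$ and $b=c=0$, then $D(\varphi,p)=p$ and $M(\varphi,p)=\{[u]^{p-1} : u\in\mathbb{F}_p^{*}\}$. (iii) If $a\neq 0$, $b=0$ and $c\neq 0$, then $D(\varphi,p)=p-1$ and $M(\varphi,p)=\{[ca^{-1}]^{p-2}\}$. (iv) If $ab\neq 0$, then $D(\varphi,p)\le 2p-1$.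
   Context: $\mathbb{F}_p$ is the field with $p$ elements and $\mathbb{F}_p^*=\mathbb{F}_p\setminus\{0\}$. A sequence in $\mathbb{F}_p$ is a finite list of elements with repetition allowed, where the order is irrelevant (i.e. a finite multiset); its length is its number of terms counted with multiplicity. The notation $[u_1]^{n_1}\cdots[u_t]^{n_t}$ denotes the sequence in which each $u_i$ is repeated $n_i$ times (if two displayed elements coincide, multiplicities add). A subsequence is a sub-multiset. A sequence $S$ is a $\varphi$-zero sequence if $\varphi(S)=0$ in $\mathbb{F}_p$, and is $\varphi$-zero free if $\varphi(T)\neq 0$ for every nonempty subsequence $T$ of $S$. $D(\varphi,p)$ is the smallest positive integer $\ell$ such that every sequence in $\mathbb{F}_p$ of length at least $\ell$ has a nonempty $\varphi$-zero subsequence. A $\varphi$-zero free sequence is extremal if its length is $D(\varphi,p)-1$, and $M(\varphi,p)$ is the set of all extremal $\varphi$-zero free sequences in $\mathbb{F}_p$. *)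

theory Defs
  imports
    "HOL-Library.Multiset"
    "HOL-Library.Cardinality"
    "HOL-Computational_Algebra.Primes"
begin

text \<open>
  A sequence over a field is a finite multiset of its elements.  The field with \<open>p\<close> elements is
  rendered as an arbitrary type \<open>'a\<close> of sort \<open>{field, finite}\<close> with \<open>CARD('a) = p\<close>,
  so the parameter \<open>p\<close> of \<open>D(\<phi>, p)\<close> and \<open>M(\<phi>, p)\<close> is carried by the type.
\<close>

definition zero_seq :: "('a multiset \<Rightarrow> 'a::zero) \<Rightarrow> 'a multiset \<Rightarrow> bool" where
  "zero_seq \<phi> S \<longleftrightarrow> \<phi> S = 0"

definition zero_free :: "('a multiset \<Rightarrow> 'a::zero) \<Rightarrow> 'a multiset \<Rightarrow> bool" where
  "zero_free \<phi> S \<longleftrightarrow> (\<forall>T. T \<subseteq># S \<and> T \<noteq> {#} \<longrightarrow> \<not> zero_seq \<phi> T)"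

text \<open>
  If no such \<open>l\<close> exists, \<open>LEAST\<close> is unspecified, so any equation or bound proved for
  \<open>davenport \<phi>\<close> has to establish the existence of such an \<open>l\<close>.
\<close>

definition davenport :: "('a multiset \<Rightarrow> 'a::zero) \<Rightarrow> nat" where
  "davenport \<phi> = (LEAST l. 0 < l \<and>
     (\<forall>S. l \<le> size S \<longrightarrow> (\<exists>T. T \<subseteq># S \<and> T \<noteq> {#} \<and> zero_seq \<phi> T)))"

definition extremal_seqs :: "('a multiset \<Rightarrow> 'a::zero) \<Rightarrow> 'a multiset set" where
  "extremal_seqs \<phi> = {S. zero_free \<phi> S \<and> size S = davenport \<phi> - 1}"

definition quad_form :: "'a \<Rightarrow> 'a \<Rightarrow> 'a \<Rightarrow> 'a multiset \<Rightarrow> 'a::field" where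
  "quad_form a b c S = a * (\<Sum>x\<in>#S. x)\<^sup>2 + b * (\<Sum>x\<in>#S. x\<^sup>2) + c * (\<Sum>x\<in>#S. x)"

end

theory Submission imports Defs "HOL-Number_Theory.Residues" begin

text \<open>
  If \<open>a = 0\<close> or \<open>b = 0\<close>, then \<open>\<phi>\<close>-zero freeness reduces to zero-sum freeness in the cyclic group
  of order \<open>p\<close>: for \<open>a = 0\<close> one replaces each term \<open>x\<close> by \<open>b x\<^sup>2 + c x\<close>, and for \<open>b = 0\<close> the value
  \<open>\<phi>(T)\<close> vanishes iff \<open>\<sigma>(T) \<in> {0, -c/a}\<close>, so that, if \<open>c \<noteq> 0\<close>, \<open>S\<close> is \<open>\<phi>\<close>-zero free iff adjoining the
  term \<open>c/a\<close> to \<open>S\<close> gives a zero-sum free sequence.  A zero-sum free sequence of length \<open>n\<close> has at least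
  \<open>n + 1\<close> subsequence sums, which bounds its length by \<open>p - 1\<close> and forces all terms to be
  equal when the length is \<open>p - 1\<close>.  If \<open>ab \<noteq> 0\<close>, it is enough that \<open>2p - 1\<close> pairs \<open>(x, x\<^sup>2)\<close> have a
  nonempty zero-sum subsequence; this is Olson's theorem, obtained by the polynomial
  method: a polynomial of degree less than \<open>n\<close> has alternating sum zero over \<open>{0,1}\<^sup>n\<close>.
\<close>

section \<open>Zero-free sequences and the Davenport constant\<close>

lemma zero_free_subset: "zero_free \<phi> S \<Longrightarrow> T \<subseteq># S \<Longrightarrow> zero_free \<phi> T"
  unfolding zero_free_def by (meson subset_mset.order_trans)

lemma not_zero_free_iff: "\<not> zero_free \<phi> S \<longleftrightarrow> (\<exists>T. T \<subseteq># S \<and> T \<noteq> {#} \<and> zero_seq \<phi> T)"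
  by (auto simp: zero_free_def)

lemma davenport_le:
  assumes "0 < l" "\<And>S. zero_free \<phi> S \<Longrightarrow> size S < l"
  shows "davenport \<phi> \<le> l"
  unfolding davenport_def not_zero_free_iff [symmetric]
  by (rule Least_le) (use assms in force)

text \<open>The witness of length \<open>n\<close> and its size exclude every admissible
  \<open>l \<le> n\<close>; the bound makes \<open>Suc n\<close> admissible, so the
  \<open>LEAST\<close> is a genuine minimum.\<close>

lemma davenport_eq_Suc:
  assumes "zero_free \<phi> S" "size S = n" and bound: "\<And>S. zero_free \<phi> S \<Longrightarrow> size S \<le> n"
  shows "davenport \<phi> = Suc n"
  unfolding davenport_def not_zero_free_iff [symmetric]
proof (rule Least_equality)
  show "0 < Suc n \<and> (\<forall>S. Suc n \<le> size S \<longrightarrow> \<not> zero_free \<phi> S)"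
    using bound by force
  show "Suc n \<le> l" if "0 < l \<and> (\<forall>S. l \<le> size S \<longrightarrow> \<not> zero_free \<phi> S)" for l
    using assms(1,2) that by (meson not_less_eq_eq)
qed

lemma subset_image_msetE:
  assumes "T \<subseteq># image_mset f S"
  obtains T' where "T' \<subseteq># S" "T = image_mset f T'"
proof -
  obtain R where "image_mset f S = T + R"
    using assms by (auto simp: subset_mset.le_iff_add)
  then obtain T' R' where "S = T' + R'" "T = image_mset f T'"
    using image_mset_eq_plusD by blast
  then show ?thesis using that[of T'] by simp
qed

text \<open>Subsequences of the image are exactly the images of subsequences, and
  \<open>image_mset\<close> preserves nonemptiness. This permits replacing the terms one by one when
  \<open>a = 0\<close>.\<close>

lemma zero_free_image_mset:
  "zero_free \<phi> (image_mset f S) \<longleftrightarrow> zero_free (\<lambda>T. \<phi> (image_mset f T)) S"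
proof
  assume "zero_free \<phi> (image_mset f S)"
  then show "zero_free (\<lambda>T. \<phi> (image_mset f T)) S"
    by (auto simp: zero_free_def zero_seq_def intro: image_mset_subseteq_mono)
next
  assume "zero_free (\<lambda>T. \<phi> (image_mset f T)) S"
  then show "zero_free \<phi> (image_mset f S)"
    unfolding zero_free_def zero_seq_def by (metis image_mset_is_empty_iff subset_image_msetE)
qed

section \<open>Zero-sum free sequences\<close>

lemma zero_free_sum_mset_iff:
  "zero_free sum_mset S \<longleftrightarrow> (\<forall>T. T \<subseteq># S \<and> sum_mset T = 0 \<longrightarrow> T = {#})"
  by (auto simp: zero_free_def zero_seq_def)

text \<open>Induction on the sequence: each further term \<open>s\<close> creates a new subsum,
  namely the total. If the total were already the sum of some \<open>T\<close> inside
  \<open>S\<close>, cancelling \<open>T\<close> would leave a zero-sum subsequence containing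
  \<open>s\<close>. The empty sum accounts for the extra one.\<close>

lemma card_subsums_ge:
  fixes S :: "'a::{ab_group_add, finite} multiset"
  assumes "zero_free sum_mset S"
  shows "Suc (size S) \<le> card (sum_mset ` {T. T \<subseteq># S})"
  using assms
proof (induction S)
  case empty
  then show ?case by simp
next
  case (add s S)
  let ?A = "\<lambda>S :: 'a multiset. sum_mset ` {T. T \<subseteq># S}"
  have new: "sum_mset (add_mset s S) \<notin> ?A S"
  proof
    assume "sum_mset (add_mset s S) \<in> ?A S"
    then obtain T where T: "T \<subseteq># S" "sum_mset (add_mset s S) = sum_mset T" by auto
    then obtain R where R: "S = T + R" by (auto simp: subset_mset.le_iff_add)
    have "sum_mset (add_mset s R) = 0" using T(2) unfolding R by (simp add: algebra_simps)
    moreover have "add_mset s R \<subseteq># add_mset s S" using R by simp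
    ultimately show False
      using add.prems unfolding zero_free_sum_mset_iff by (metis add_mset_not_empty)
  qed
  have "zero_free sum_mset S" by (rule zero_free_subset [OF add.prems]) simp
  then have "Suc (size (add_mset s S)) \<le> card (insert (sum_mset (add_mset s S)) (?A S))"
    using add.IH new by simp
  also have "\<dots> \<le> card (?A (add_mset s S))"
  proof (rule card_mono)
    show "insert (sum_mset (add_mset s S)) (?A S) \<subseteq> ?A (add_mset s S)"
    proof -
      have "S \<subseteq># add_mset s S" by simp
      then have "{T. T \<subseteq># S} \<subseteq> {T. T \<subseteq># add_mset s S}"
        using subset_mset.order_trans by blast
      then show ?thesis by blast
    qed
  qed simp
  finally show ?case .
qed

lemma size_less_card_if_zero_sum_free:
  fixes S :: "'a::{ab_group_add, finite} multiset"
  assumes "zero_free sum_mset S"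
  shows "size S < CARD('a)"
  using Suc_le_lessD [OF card_subsums_ge [OF assms]] card_mono [OF finite subset_UNIV]
  by (rule less_le_trans)

text \<open>If two terms \<open>x\<close> and \<open>y\<close> differ, let \<open>R\<close> be the
  rest. Its at least \<open>size R + 1\<close> subsums, shifted by \<open>x + y\<close>, avoid the
  three distinct elements \<open>0\<close>, \<open>x\<close>, \<open>y\<close>. Hence
  \<open>size R + 1 \<le> CARD('a) - 3\<close>, so \<open>S\<close> is too short.\<close>

lemma extremal_zero_sum_free_eq:
  fixes S :: "'a::{ab_group_add, finite} multiset"
  assumes free: "zero_free sum_mset S" and size: "CARD('a) \<le> Suc (size S)"
    and "x \<in># S" "y \<in># S"
  shows "x = y"
proof (rule ccontr)
  assume "x \<noteq> y"
  then obtain R where S: "S = add_mset x (add_mset y R)"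
    using assms(3,4) by (metis insert_DiffM insert_noteq_member)
  let ?A = "sum_mset ` {T. T \<subseteq># R}"
  have nz: "sum_mset (B + T) \<noteq> 0" if "T \<subseteq># R" "B \<subseteq># {#x, y#}" "B \<noteq> {#}" for B T
  proof -
    have "B + T \<subseteq># S" unfolding S using subset_mset.add_mono [OF that(2,1)] by simp
    with free that(3) show ?thesis by (auto simp: zero_free_sum_mset_iff)
  qed
  \<comment> \<open>A shifted subsum \<open>x + y + z\<close> equal to \<open>0\<close>,
    \<open>x\<close> or \<open>y\<close> would give a zero-sum subsequence containing both
    \<open>x\<close> and \<open>y\<close>, only \<open>y\<close>, or only \<open>x\<close> besides
    the part from \<open>R\<close>.\<close>
  have "{0, x, y} \<inter> (\<lambda>z. x + y + z) ` ?A = {}"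
    using nz [where B = "{#x, y#}"] nz [where B = "{#x#}"] nz [where B = "{#y#}"]
    by (auto simp: add.assoc add.left_commute)
  then have "(\<lambda>z. x + y + z) ` ?A \<subseteq> UNIV - {0, x, y}" by auto
  then have "card ((\<lambda>z. x + y + z) ` ?A) \<le> card (UNIV - {0, x, y})"
    by (intro card_mono) auto
  moreover have "card ((\<lambda>z. x + y + z) ` ?A) = card ?A"
    by (rule card_image) (simp add: inj_on_def)
  moreover have "Suc (size R) \<le> card ?A"
    using S by (intro card_subsums_ge zero_free_subset [OF free]) (simp add: subset_mset.le_iff_add)
  moreover have "x \<noteq> 0" "y \<noteq> 0"
    using nz [where B = "{#x#}" and T = "{#}"] nz [where B = "{#y#}" and T = "{#}"] by auto
  then have "card {0, x, y} = 3" using \<open>x \<noteq> y\<close> by simp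
  \<comment> \<open>The bound \<open>3 \<le> CARD('a)\<close> keeps the natural subtraction from
    truncating.\<close>
  then have "card (UNIV - {0, x, y}) = CARD('a) - 3" "3 \<le> CARD('a)"
    using card_mono [of UNIV "{0, x, y}"] by (auto simp: card_Diff_subset)
  ultimately show False using size S by simp
qed

text \<open>The characteristic divides the prime \<open>CARD('a)\<close> and is not 1, so it equals
  \<open>CARD('a)\<close>.\<close>

lemma of_nat_neq_0_if_less_card:
  assumes "prime CARD('a::{field, finite})" "0 < n" "n < CARD('a)"
  shows "(of_nat n :: 'a) \<noteq> 0"
proof -
  have "CHAR('a) = CARD('a)"
    using assms(1) CHAR_dvd_CARD [where 'a = 'a] CHAR_not_1 [where 'a = 'a]
    by (metis One_nat_def prime_nat_iff)
  then show ?thesis using assms(2,3) by (auto simp: of_nat_eq_0_iff_char_dvd dest: dvd_imp_le)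
qed

lemma zero_sum_free_replicate_mset:
  fixes u :: "'a::{field, finite}"
  assumes "prime CARD('a)" "u \<noteq> 0" "n < CARD('a)"
  shows "zero_free sum_mset (replicate_mset n u)"
  unfolding zero_free_sum_mset_iff
proof (intro allI impI, elim conjE)
  fix T assume "T \<subseteq># replicate_mset n u" and 0: "sum_mset T = 0"
  then obtain k where k: "k \<le> n" "T = replicate_mset k u"
    by (metis msubseteq_replicate_msetE)
  with 0 assms(2) have "(of_nat k :: 'a) = 0" by simp
  then have "k = 0" using of_nat_neq_0_if_less_card [OF assms(1), of k] k assms(3) by linarith
  then show "T = {#}" using k by simp
qed

text \<open>The inverse problem for zero-sum free sequences; all three descriptions of extremal
  sequences below are read off from it.\<close>

lemma zero_sum_free_card_minus_1_iff:
  fixes S :: "'a::{field, finite} multiset"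
  assumes "prime CARD('a)"
  shows "zero_free sum_mset S \<and> size S = CARD('a) - 1 \<longleftrightarrow>
    (\<exists>u. u \<noteq> 0 \<and> S = replicate_mset (CARD('a) - 1) u)"
proof
  assume *: "zero_free sum_mset S \<and> size S = CARD('a) - 1"
  have "1 < CARD('a)" using assms prime_gt_1_nat by blast
  with * obtain u where u: "u \<in># S" by (metis size_empty multiset_nonemptyE zero_less_diff less_irrefl)
  have "x = u" if "x \<in># S" for x
    using extremal_zero_sum_free_eq [of S x u] * that u by simp
  then have "S = replicate_mset (CARD('a) - 1) u"
    using * by (metis set_mset_subset_singletonD singletonI subsetI)
  moreover have "u \<noteq> 0"
    using * u unfolding zero_free_sum_mset_iff
    by (metis add_mset_not_empty mset_subset_eq_single sum_mset.singleton)
  ultimately show "\<exists>u. u \<noteq> 0 \<and> S = replicate_mset (CARD('a) - 1) u" by blast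
next
  assume "\<exists>u. u \<noteq> 0 \<and> S = replicate_mset (CARD('a) - 1) u"
  then show "zero_free sum_mset S \<and> size S = CARD('a) - 1"
    using assms by (auto intro!: zero_sum_free_replicate_mset simp: prime_gt_0_nat)
qed

section \<open>Olson's theorem\<close>

text \<open>The alternating sum is an iterated finite difference, one per element of
  \<open>I\<close>, and each difference lowers the degree. Instead of polynomials, products of
  \<open>card J\<close> affine forms are used: differencing in direction \<open>x\<close> leaves
  combinations of products over proper subsets of \<open>J\<close>, to which the induction
  hypothesis applies.\<close>

lemma alternating_sum_prod_affine_eq_0:
  fixes v :: "'j \<Rightarrow> 'i \<Rightarrow> 'a::comm_ring_1"
  assumes "finite I" "finite J" "card J < card I"
  shows "(\<Sum>T\<in>Pow I. (- 1) ^ card T * (\<Prod>j\<in>J. w j + (\<Sum>i\<in>T. v j i))) = 0"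
  using assms
proof (induction I arbitrary: J rule: finite_induct)
  case empty
  then show ?case by simp
next
  case (insert x I)
  let ?L = "\<lambda>T j. w j + (\<Sum>i\<in>T. v j i)"
  let ?P = "\<lambda>J T. \<Prod>j\<in>J. ?L T j"
  have fin: "finite T" and notin: "x \<notin> T" if "T \<in> Pow I" for T
    using that insert.hyps finite_subset by auto
  have "(\<Sum>T\<in>Pow (insert x I). (- 1) ^ card T * ?P J T)
      = (\<Sum>T\<in>Pow I. (- 1) ^ card T * ?P J T)
        + (\<Sum>T\<in>insert x ` Pow I. (- 1) ^ card T * ?P J T)"
    unfolding Pow_insert using insert.hyps by (intro sum.union_disjoint) auto
  also have "(\<Sum>T\<in>insert x ` Pow I. (- 1) ^ card T * ?P J T)
      = (\<Sum>T\<in>Pow I. - ((- 1) ^ card T * (\<Prod>j\<in>J. ?L T j + v j x)))"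
  proof (subst sum.reindex)
    show "inj_on (insert x) (Pow I)" using notin by (meson inj_onI insert_ident)
  qed (use fin notin in \<open>auto simp: algebra_simps intro!: sum.cong\<close>)
  \<comment> \<open>Multiply out: \<open>K\<close> collects the indices where the old affine form is
    chosen, the other indices contribute the increment \<open>v j x\<close>.\<close>
  also have "\<dots> = (\<Sum>T\<in>Pow I. - ((- 1) ^ card T * (\<Sum>K\<in>Pow J. ?P K T * (\<Prod>j\<in>J - K. v j x))))"
    using insert.prems by (simp add: prod_add)
  \<comment> \<open>The term for \<open>K = J\<close> cancels against the sum over the sets without
    \<open>x\<close>; only proper subsets of \<open>J\<close> remain.\<close>
  also have "(\<Sum>T\<in>Pow I. (- 1) ^ card T * ?P J T) + \<dots>
      = - (\<Sum>T\<in>Pow I. \<Sum>K\<in>Pow J - {J}. (\<Prod>j\<in>J - K. v j x) * ((- 1) ^ card T * ?P K T))"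
    using insert.prems
    by (simp add: sum.remove [of "Pow J" J] sum_distrib_left algebra_simps
        sum_negf sum.distrib sum_subtractf)
  also have "\<dots> = - (\<Sum>K\<in>Pow J - {J}. (\<Prod>j\<in>J - K. v j x) *
      (\<Sum>T\<in>Pow I. (- 1) ^ card T * ?P K T))"
    by (subst sum.swap) (simp add: sum_distrib_left)
  also have "\<dots> = 0"
  proof -
    have "(\<Sum>T\<in>Pow I. (- 1) ^ card T * ?P K T) = 0" if "K \<in> Pow J - {J}" for K
    proof (rule insert.IH)
      show "finite K" using that insert.prems finite_subset by auto
      have "card K < card J" using that insert.prems by (intro psubset_card_mono) auto
      then show "card K < card I" using insert.prems insert.hyps by simp
    qed
    then show ?thesis by simp
  qed
  finally show ?case .
qed

lemma one_less_card: "1 < CARD('a::{zero_neq_one, finite})"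
  using card_mono [of UNIV "{0, 1 :: 'a}"] by simp

text \<open>The product \<open>?F\<close> has \<open>card D * (CARD('a) - 1)\<close> affine factors,
  fewer than \<open>card I\<close>, so its alternating sum is zero. The empty set contributes a
  nonzero term, which some nonempty \<open>T\<close> must cancel; at that \<open>T\<close> all forms
  vanish.\<close>

lemma olson:
  fixes v :: "'d \<Rightarrow> 'i \<Rightarrow> 'a::{idom, finite}"
  assumes "finite I" "finite D" "card D * (CARD('a) - 1) < card I"
  obtains T where "T \<subseteq> I" "T \<noteq> {}" "\<And>d. d \<in> D \<Longrightarrow> (\<Sum>i\<in>T. v d i) = 0"
proof -
  let ?J = "D \<times> (UNIV - {0 :: 'a})"
  \<comment> \<open>Up to a nonzero factor, the indicator function of the common zeros of the forms.\<close>
  let ?F = "\<lambda>T. \<Prod>j\<in>?J. - snd j + (\<Sum>i\<in>T. v (fst j) i)"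
  have "card ?J < card I" using assms by (simp add: card_cartesian_product)
  then have 0: "(\<Sum>T\<in>Pow I. (- 1) ^ card T * ?F T) = 0"
    using assms by (intro alternating_sum_prod_affine_eq_0) auto
  have "\<exists>T\<in>Pow I - {{}}. ?F T \<noteq> 0"
  proof (rule ccontr)
    assume "\<not> (\<exists>T\<in>Pow I - {{}}. ?F T \<noteq> 0)"
    then have "(\<Sum>T\<in>Pow I. (- 1) ^ card T * ?F T) = ?F {}"
      using assms(1) by (subst sum.remove [of _ "{}"]) auto
    \<comment> \<open>At the empty set every factor is \<open>- e\<close> with
      \<open>e \<noteq> 0\<close>, and there are no zero divisors.\<close>
    moreover have "?F {} \<noteq> 0" using assms(2) by auto
    ultimately show False using 0 by simp
  qed
  then obtain T where T: "T \<subseteq> I" "T \<noteq> {}" "?F T \<noteq> 0" by auto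
  have "(\<Sum>i\<in>T. v d i) = 0" if "d \<in> D" for d
  proof (rule ccontr)
    assume "(\<Sum>i\<in>T. v d i) \<noteq> 0"
    \<comment> \<open>A nonzero value of the form is itself one of the subtracted constants, so its
      factor is zero.\<close>
    then have "(d, \<Sum>i\<in>T. v d i) \<in> ?J" using that by auto
    then have "?F T = 0" using assms(2) by (intro prod_zero) force+
    then show False using T by simp
  qed
  then show ?thesis using that T by blast
qed

text \<open>Positions in a list keep equal terms apart, so sets of positions yield sub-multisets.
  The type \<open>bool\<close> indexes the two forms, and \<open>2 * (CARD('a) - 1)\<close> is one
  less than the required length.\<close>

lemma olson_mset:
  fixes f g :: "'b \<Rightarrow> 'a::{idom, finite}"
  assumes "2 * CARD('a) - 1 \<le> size S"
  obtains T where "T \<subseteq># S" "T \<noteq> {#}" "(\<Sum>x\<in>#T. f x) = 0" "(\<Sum>x\<in>#T. g x) = 0"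
proof -
  obtain xs where xs: "mset xs = S" using ex_mset by blast
  let ?I = "{..<length xs}"
  have "1 < CARD('a)" by (rule one_less_card)
  then have "card (UNIV :: bool set) * (CARD('a) - 1) < card ?I"
    using assms xs by auto
  then obtain T where T: "T \<subseteq> ?I" "T \<noteq> {}"
    "\<And>d. (\<Sum>i\<in>T. (if d then f else g) (xs ! i)) = 0"
    using olson [of ?I UNIV "\<lambda>d i. (if d then f else g) (xs ! i)"] by auto
  have "finite T" using T(1) finite_subset by blast
  let ?T = "image_mset (\<lambda>i. xs ! i) (mset_set T)"
  have "?T \<subseteq># image_mset (\<lambda>i. xs ! i) (mset_set ?I)"
    using T(1) by (intro image_mset_subseteq_mono subset_imp_msubset_mset_set) auto
  also have "\<dots> = S"
    using xs by (metis map_nth mset_map mset_upt atLeast0LessThan)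
  finally have "?T \<subseteq># S" .
  moreover have "?T \<noteq> {#}" using T(2) \<open>finite T\<close> by (simp add: mset_set_empty_iff)
  moreover have "(\<Sum>x\<in>#?T. f x) = 0" "(\<Sum>x\<in>#?T. g x) = 0"
    using T(3)[of True] T(3)[of False] by (auto simp: sum_unfold_sum_mset multiset.map_comp comp_def)
  ultimately show ?thesis using that by blast
qed

section \<open>The quadratic forms\<close>

lemma mset_eq_replicate_plus_replicate:
  assumes "\<And>x. x \<in># S \<Longrightarrow> x = u \<or> x = v"
  shows "\<exists>k\<le>size S. S = replicate_mset k u + replicate_mset (size S - k) v"
  using assms
proof (induction S)
  case empty
  then show ?case by simp
next
  case (add s S)
  then obtain k where k: "k \<le> size S" "S = replicate_mset k u + replicate_mset (size S - k) v"
    by auto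
  consider "s = u" | "s = v" using add.prems by auto
  then show ?case
  proof cases
    case 1
    then show ?thesis using k by (intro exI [of _ "Suc k"]) simp
  next
    case 2
    then show ?thesis using k by (intro exI [of _ k]) (simp add: Suc_diff_le)
  qed
qed

lemma quad_form_0_left: "quad_form 0 b c S = sum_mset (image_mset (\<lambda>x. b * x\<^sup>2 + c * x) S)"
  by (simp add: quad_form_def sum_mset.distrib flip: sum_mset_distrib_left)

lemma zero_free_quad_form_0_left:
  "zero_free (quad_form 0 b c) S \<longleftrightarrow> zero_free sum_mset (image_mset (\<lambda>x. b * x\<^sup>2 + c * x) S)"
  unfolding zero_free_image_mset quad_form_0_left ..

lemma zero_free_quad_form_square:
  assumes "a \<noteq> 0"
  shows "zero_free (quad_form a 0 0) S \<longleftrightarrow> zero_free sum_mset S"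
  using assms by (simp add: zero_free_def zero_seq_def quad_form_def)

text \<open>With \<open>s = sum_mset T\<close> and \<open>d = c * inverse a\<close> the form factors
  as \<open>a * s * (s + d)\<close>. Its two roots correspond to the two kinds of subsequences of
  \<open>add_mset d S\<close>: those inside \<open>S\<close>, and those using the adjoined
  \<open>d\<close>.\<close>

lemma zero_free_quad_form_0_mid:
  fixes a c :: "'a::field"
  assumes "a \<noteq> 0" "c \<noteq> 0"
  shows "zero_free (quad_form a 0 c) S \<longleftrightarrow> zero_free sum_mset (add_mset (c * inverse a) S)"
    (is "_ \<longleftrightarrow> zero_free _ (add_mset ?d S)")
proof -
  have eq0: "quad_form a 0 c T = 0 \<longleftrightarrow> sum_mset T = 0 \<or> sum_mset (add_mset ?d T) = 0" for T
  proof -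
    have "quad_form a 0 c T = a * (sum_mset T * sum_mset (add_mset ?d T))"
      using assms by (simp add: quad_form_def power2_eq_square field_simps)
    then show ?thesis using assms by simp
  qed
  have d: "?d \<noteq> 0" using assms by simp
  show ?thesis
  proof
    assume L: "zero_free (quad_form a 0 c) S"
    show "zero_free sum_mset (add_mset ?d S)"
      unfolding zero_free_sum_mset_iff
    proof (intro allI impI, elim conjE)
      fix T assume T: "T \<subseteq># add_mset ?d S" "sum_mset T = 0"
      show "T = {#}"
      proof (cases "T \<subseteq># S")
        case True
        then show ?thesis using L T eq0 by (auto simp: zero_free_def zero_seq_def)
      next
        case False
        then have "?d \<in># T" using T(1)
          by (metis diff_single_trivial subset_eq_diff_conv add_mset_add_single)
        then obtain R where R: "T = add_mset ?d R" by (metis insert_DiffM)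
        then have "R \<subseteq># S" using T(1) by simp
        \<comment> \<open>Freeness of the form says nothing about empty \<open>R\<close>; there the
          sum is \<open>?d\<close> alone, which is nonzero.\<close>
        moreover have "R \<noteq> {#}" using R T(2) d by auto
        ultimately show ?thesis using L T(2) R eq0 by (auto simp: zero_free_def zero_seq_def)
      qed
    qed
  next
    assume R: "zero_free sum_mset (add_mset ?d S)"
    show "zero_free (quad_form a 0 c) S"
      unfolding zero_free_def zero_seq_def eq0
    proof (intro allI impI notI, elim conjE)
      fix T assume T: "T \<subseteq># S" "T \<noteq> {#}" "sum_mset T = 0 \<or> sum_mset (add_mset ?d T) = 0"
      have "T \<subseteq># add_mset ?d S" "add_mset ?d T \<subseteq># add_mset ?d S"
        using T(1) by (simp_all add: subset_mset.order_trans [of T S])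
      then show False using R T(2,3) unfolding zero_free_sum_mset_iff
        by (metis add_mset_not_empty)
    qed
  qed
qed

text \<open>The map \<open>?f\<close> has fibres \<open>{u, - u - c * inverse b}\<close>. An
  extremal sequence has constant nonzero image under \<open>?f\<close>, so its terms lie in a single
  fibre other than that of the roots \<open>0\<close> and \<open>- c * inverse b\<close>.\<close>

lemma davenport_extremal_quad_form_0_left:
  fixes b c :: "'a::{field, finite}"
  assumes p: "prime CARD('a)" "odd CARD('a)" and b: "b \<noteq> 0"
  shows "davenport (quad_form 0 b c) = CARD('a)"
    and "extremal_seqs (quad_form 0 b c) =
      {replicate_mset k u + replicate_mset (CARD('a) - 1 - k) (- u - c * inverse b) | u k.
        u \<noteq> 0 \<and> u \<noteq> - c * inverse b \<and> k \<le> CARD('a) - 1}" (is "_ = ?M")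
proof -
  let ?f = "\<lambda>x. b * x\<^sup>2 + c * x"
  let ?n = "CARD('a) - 1"
  have p3: "3 \<le> CARD('a)"
    using p prime_ge_2_nat [OF p(1)] by (cases "CARD('a) = 2") auto
  have f0: "?f x = 0 \<longleftrightarrow> x = 0 \<or> x = - c * inverse b" for x
  proof -
    have "?f x = b * x * (x - (- c * inverse b))"
      using b by (simp add: field_simps power2_eq_square)
    then show ?thesis using b by (metis eq_iff_diff_eq_0 mult_eq_0_iff)
  qed
  have feq: "?f x = ?f u \<longleftrightarrow> x = u \<or> x = - u - c * inverse b" for x u
  proof -
    have "?f x - ?f u = b * (x - u) * (x - (- u - c * inverse b))"
      using b by (simp add: field_simps power2_eq_square)
    then show ?thesis using b by (metis eq_iff_diff_eq_0 mult_eq_0_iff)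
  qed
  \<comment> \<open>Oddness of the cardinality enters here: the at most two roots of
    \<open>?f\<close> do not exhaust the field, so a constant sequence with nonzero image
    exists.\<close>
  have "card {0, - c * inverse b} \<le> 2" by (simp add: card_insert_if)
  then have "UNIV \<noteq> {0, - c * inverse b}" using p3 by (metis not_less_eq_eq numeral_2_eq_2 numeral_3_eq_3)
  then obtain u where u: "?f u \<noteq> 0" unfolding f0 by blast
  have free: "zero_free (quad_form 0 b c) S \<and> size S = ?n \<longleftrightarrow>
      (\<exists>g. g \<noteq> 0 \<and> image_mset ?f S = replicate_mset ?n g)" for S
    using zero_sum_free_card_minus_1_iff [OF p(1), of "image_mset ?f S"]
    by (simp add: zero_free_quad_form_0_left)
  have "davenport (quad_form 0 b c) = Suc ?n"
  proof (rule davenport_eq_Suc)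
    show "zero_free (quad_form 0 b c) (replicate_mset ?n u)"
      using free [of "replicate_mset ?n u"] u by auto
    show "size S \<le> ?n" if "zero_free (quad_form 0 b c) S" for S
      using size_less_card_if_zero_sum_free that unfolding zero_free_quad_form_0_left
      by (metis Suc_leI diff_le_mono diff_Suc_1 size_image_mset)
  qed simp
  then show D: "davenport (quad_form 0 b c) = CARD('a)" using p3 by simp
  show "extremal_seqs (quad_form 0 b c) = ?M"
    unfolding extremal_seqs_def D free
  proof (intro Set.equalityI subsetI)
    fix S assume "S \<in> {S. \<exists>g. g \<noteq> 0 \<and> image_mset ?f S = replicate_mset ?n g}"
    then obtain g where g: "g \<noteq> 0" "image_mset ?f S = replicate_mset ?n g" by auto
    have size: "size S = ?n" using g(2) by (metis size_image_mset size_replicate_mset)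
    have fg: "?f x = g" if "x \<in># S" for x
      using that g(2) by (metis (no_types, lifting) image_eqI in_replicate_mset set_image_mset)
    obtain u where u: "u \<in># S"
      using size p3 by (metis size_empty multiset_nonemptyE diff_is_0_eq not_less_eq_eq numeral_3_eq_3 One_nat_def le_SucI)
    have "\<exists>k\<le>size S. S = replicate_mset k u + replicate_mset (size S - k) (- u - c * inverse b)"
      using fg u feq by (intro mset_eq_replicate_plus_replicate) metis
    moreover have "u \<noteq> 0" "u \<noteq> - c * inverse b" using fg [OF u] g(1) f0 [of u] by auto
    ultimately show "S \<in> ?M" unfolding size by blast
  next
    fix S assume "S \<in> ?M"
    then obtain u k where u: "u \<noteq> 0" "u \<noteq> - c * inverse b" and k: "k \<le> ?n"
      and S: "S = replicate_mset k u + replicate_mset (?n - k) (- u - c * inverse b)" by auto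
    have "?f (- u - c * inverse b) = ?f u" unfolding feq by simp
    then have "image_mset ?f S = replicate_mset ?n (?f u)"
      unfolding S using k by (intro multiset_eqI) auto
    then show "S \<in> {S. \<exists>g. g \<noteq> 0 \<and> image_mset ?f S = replicate_mset ?n g}"
      using u f0 by blast
  qed
qed

lemma davenport_extremal_quad_form_square:
  fixes a :: "'a::{field, finite}"
  assumes p: "prime CARD('a)" and a: "a \<noteq> 0"
  shows "davenport (quad_form a 0 0) = CARD('a)"
    and "extremal_seqs (quad_form a 0 0) = {replicate_mset (CARD('a) - 1) u | u. u \<noteq> 0}"
proof -
  note free = zero_free_quad_form_square [OF a]
  have p1: "1 < CARD('a)" using p prime_gt_1_nat by blast
  have "davenport (quad_form a 0 0) = Suc (CARD('a) - 1)"
  proof (rule davenport_eq_Suc)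
    show "zero_free (quad_form a 0 0) (replicate_mset (CARD('a) - 1) 1)"
      using p1 unfolding free by (intro zero_sum_free_replicate_mset p) auto
    show "size S \<le> CARD('a) - 1" if "zero_free (quad_form a 0 0) S" for S
      using size_less_card_if_zero_sum_free [of S] that unfolding free by simp
  qed simp
  then show D: "davenport (quad_form a 0 0) = CARD('a)" using p1 by simp
  show "extremal_seqs (quad_form a 0 0) = {replicate_mset (CARD('a) - 1) u | u. u \<noteq> 0}"
    unfolding extremal_seqs_def D free zero_sum_free_card_minus_1_iff [OF p] by auto
qed

text \<open>Adjoining \<open>c * inverse a\<close> uses up one place of a zero-sum free sequence,
  which lowers the constant by one and fixes the repeated value.\<close>

lemma davenport_extremal_quad_form_0_mid:
  fixes a c :: "'a::{field, finite}"
  assumes p: "prime CARD('a)" and a: "a \<noteq> 0" and c: "c \<noteq> 0"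
  shows "davenport (quad_form a 0 c) = CARD('a) - 1"
    and "extremal_seqs (quad_form a 0 c) = {replicate_mset (CARD('a) - 2) (c * inverse a)}"
proof -
  let ?d = "c * inverse a"
  note free = zero_free_quad_form_0_mid [OF a c]
  have p2: "2 \<le> CARD('a)" using p prime_ge_2_nat by blast
  have d: "?d \<noteq> 0" using a c by simp
  have ex: "zero_free (quad_form a 0 c) S \<and> size S = CARD('a) - 2 \<longleftrightarrow>
      S = replicate_mset (CARD('a) - 2) ?d" for S
  proof -
    have n: "CARD('a) - 1 = Suc (CARD('a) - 2)" using p2 by simp
    have "zero_free (quad_form a 0 c) S \<and> size S = CARD('a) - 2 \<longleftrightarrow>
        (\<exists>u. u \<noteq> 0 \<and> add_mset ?d S = replicate_mset (CARD('a) - 1) u)"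
      unfolding free zero_sum_free_card_minus_1_iff [OF p, symmetric] using n by auto
    also have "\<dots> \<longleftrightarrow> S = replicate_mset (CARD('a) - 2) ?d"
    proof
      assume "\<exists>u. u \<noteq> 0 \<and> add_mset ?d S = replicate_mset (CARD('a) - 1) u"
      then obtain u where u: "add_mset ?d S = replicate_mset (CARD('a) - 1) u" by blast
      \<comment> \<open>The adjoined term is itself one of the equal terms.\<close>
      then have "?d = u" by (metis in_replicate_mset union_single_eq_member)
      then show "S = replicate_mset (CARD('a) - 2) ?d" using u n by simp
    next
      assume "S = replicate_mset (CARD('a) - 2) ?d"
      then show "\<exists>u. u \<noteq> 0 \<and> add_mset ?d S = replicate_mset (CARD('a) - 1) u"
        using d n by (intro exI [of _ ?d]) simp
    qed
    finally show ?thesis .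
  qed
  have "davenport (quad_form a 0 c) = Suc (CARD('a) - 2)"
  proof (rule davenport_eq_Suc)
    show "zero_free (quad_form a 0 c) (replicate_mset (CARD('a) - 2) ?d)" using ex by blast
    show "size S \<le> CARD('a) - 2" if "zero_free (quad_form a 0 c) S" for S
      using size_less_card_if_zero_sum_free [of "add_mset ?d S"] that unfolding free by simp
  qed simp
  then show D: "davenport (quad_form a 0 c) = CARD('a) - 1" using p2 by simp
  then show "extremal_seqs (quad_form a 0 c) = {replicate_mset (CARD('a) - 2) ?d}"
    unfolding extremal_seqs_def D using ex by (auto simp: numeral_2_eq_2)
qed

text \<open>All three summands of the form vanish once the sum and the sum of squares do, and
  \<open>olson_mset\<close> for \<open>x\<close> and \<open>x\<^sup>2\<close> makes both
  vanish.\<close>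

lemma davenport_quad_form_le:
  fixes a b c :: "'a::{field, finite}"
  shows "davenport (quad_form a b c) \<le> 2 * CARD('a) - 1"
proof (rule davenport_le)
  have "1 < CARD('a)" by (rule one_less_card)
  then show "0 < 2 * CARD('a) - 1" by simp
  show "size S < 2 * CARD('a) - 1" if "zero_free (quad_form a b c) S" for S
  proof (rule ccontr)
    assume "\<not> size S < 2 * CARD('a) - 1"
    then obtain T where "T \<subseteq># S" "T \<noteq> {#}" "(\<Sum>x\<in>#T. x) = 0" "(\<Sum>x\<in>#T. x\<^sup>2) = 0"
      using olson_mset [of S "\<lambda>x. x" "\<lambda>x. x\<^sup>2"] by (metis not_less)
    moreover from this have "zero_seq (quad_form a b c) T" by (simp add: zero_seq_def quad_form_def)
    ultimately show False using that unfolding zero_free_def by blast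
  qed
qed

theorem theorem2p1:
  fixes p :: nat and a b c :: "'a::{field, finite}"
  assumes "prime p" and "odd p" and "CARD('a) = p"
    and "\<not> (a = 0 \<and> b = 0)"
  shows
    "(a = 0 \<and> b \<noteq> 0 \<longrightarrow>
        davenport (quad_form a b c) = p \<and>
        extremal_seqs (quad_form a b c) =
          {replicate_mset \<alpha> u + replicate_mset (p - 1 - \<alpha>) (- u - c * inverse b) | u \<alpha>.
             u \<in> UNIV - {0, - c * inverse b} \<and> 0 \<le> \<alpha> \<and> \<alpha> \<le> p - 1}) \<and>
     (a \<noteq> 0 \<and> b = 0 \<and> c = 0 \<longrightarrow>
        davenport (quad_form a b c) = p \<and>
        extremal_seqs (quad_form a b c) = {replicate_mset (p - 1) u | u. u \<in> UNIV - {0}}) \<and>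
     (a \<noteq> 0 \<and> b = 0 \<and> c \<noteq> 0 \<longrightarrow>
        davenport (quad_form a b c) = p - 1 \<and>
        extremal_seqs (quad_form a b c) = {replicate_mset (p - 2) (c * inverse a)}) \<and>
     (a * b \<noteq> 0 \<longrightarrow> davenport (quad_form a b c) \<le> 2 * p - 1)"
proof (intro conjI impI)
  have p: "prime CARD('a)" "odd CARD('a)" using assms(1-3) by simp_all
  show "davenport (quad_form a b c) = p" if "a = 0 \<and> b \<noteq> 0"
    using that davenport_extremal_quad_form_0_left(1) [OF p, of b c] assms(3) by simp
  show "extremal_seqs (quad_form a b c) =
      {replicate_mset \<alpha> u + replicate_mset (p - 1 - \<alpha>) (- u - c * inverse b) | u \<alpha>.
         u \<in> UNIV - {0, - c * inverse b} \<and> 0 \<le> \<alpha> \<and> \<alpha> \<le> p - 1}" if "a = 0 \<and> b \<noteq> 0"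
    using that davenport_extremal_quad_form_0_left(2) [OF p, of b c] assms(3) by simp
  show "davenport (quad_form a b c) = p" if "a \<noteq> 0 \<and> b = 0 \<and> c = 0"
    using that davenport_extremal_quad_form_square(1) [OF p(1), of a] assms(3) by simp
  show "extremal_seqs (quad_form a b c) = {replicate_mset (p - 1) u | u. u \<in> UNIV - {0}}"
    if "a \<noteq> 0 \<and> b = 0 \<and> c = 0"
    using that davenport_extremal_quad_form_square(2) [OF p(1), of a] assms(3) by simp
  show "davenport (quad_form a b c) = p - 1" if "a \<noteq> 0 \<and> b = 0 \<and> c \<noteq> 0"
    using that davenport_extremal_quad_form_0_mid(1) [OF p(1), of a c] assms(3) by simp
  show "extremal_seqs (quad_form a b c) = {replicate_mset (p - 2) (c * inverse a)}"
    if "a \<noteq> 0 \<and> b = 0 \<and> c \<noteq> 0"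
    using that davenport_extremal_quad_form_0_mid(2) [OF p(1), of a c] assms(3) by simp
  show "davenport (quad_form a b c) \<le> 2 * p - 1"
    using davenport_quad_form_le [of a b c] assms(3) by simp
qed

end
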